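(* Let $\mathcal{R}=(V,E,E^{*})$ be a non-empty R-simple R-graph. Then $\mathcal{R}$ has an R-cycle if and only if there exists an R-component $\mathcal{R}_{W}=(W,E_{W},E^{*}_{W})$ of $\mathcal{R}$, with set $\mathfrak{U}_{W}$ of R-neighbour sets, such that $|W|-|\mathfrak{U}_{W}|-\omega+1\ne 0$, where $\omega$ is the number of connected components of the graph $(W,E_{W})$. In particular, if $\mathcal{R}$ is proper and $|\mathfrak{L}(\mathcal{R})|\geq |\mathfrak{N}(\mathcal{R})|$, then $\mathcal{R}$ has an R-cycle.
   Context: All graphs are finite, simple and undirected. A path $v_0v_1\cdots v_p$ has pairwise distinct vertices; its origin is $v_0$ and its terminus is $v_p$. Components are connected components, regarded as vertex sets (an isolated vertex forms a component). R-graph: let $\mathcal{G}=(V,E)$ and $\mathcal{G}^{*}=(V,E^{*})$ be simple graphs with the same vertex set. For $v\in V$ put $U(v)=\{w\in V\mid vw\in E^{*}\}\cup\{v\}$ (the R-neighbour set of $v$). The triple $\mathcal{R}=(V,E,E^{*})$ is an R-graph if $|U(v)\cap C|\leq 1$ for every $v\in V$ and every component $C$ of $\mathcal{G}$. Put $\mathfrak{U}=\{U(v)\mid v\in V\}$ (a set, so equal R-neighbour sets are counted once). $\mathcal{R}$ is non-empty if $E\neq\emptyset$, and proper if $\mathcal{G}$ has no isolated vertices. R-cycle: let $p>1$ and let $\pi_q$ ($1\le q\le p$) be a path in $\mathcal{G}$ with origin $v_q$ and terminus $w_q$. The sequence $(\pi_1,\dots,\pi_p)$ is an R-cycle (of length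 $p$) in $\mathcal{R}$ if all of the $v_q$'s and $w_q$'s are different from each other, $w_qv_{q+1}\in E^{*}$ for $1\leq q\leq p-1$, and $w_pv_1\in E^{*}$. R-simple: $\mathcal{R}$ is R-simple if (i) for all $U,U'\in\mathfrak{U}$ either $U\cap U'=\emptyset$ or $U=U'$ (so $\mathfrak{U}$ is a partition of $V$), and (ii) there are no R-cycles of length 2 consisting of edges, i.e. for edges $vw,v'w'\in E$ with $vv'\in E^{*}$ one has $ww'\notin E^{*}$. R-components: for an R-simple $\mathcal{R}$, $U,U'\in\mathfrak{U}$ are R-connected if there is a finite sequence $U_0e_1U_1\cdots e_pU_p$ (possibly $p=0$) with $U_q\in\mathfrak{U}$, $e_q=v_qw_q\in E$, $U_0=U$, $U_p=U'$, $v_q\in U_{q-1}$, $w_q\in U_q$. This is an equivalence relation on $\mathfrak{U}$; let $\mathfrak{U}_1,\dots,\mathfrak{U}_m$ be its classes and $W_i=\bigcup_{U\in\mathfrak{U}_i}U$. The R-components of $\mathcal{R}$ are the subgraphs $\mathcal{R}_{W_i}=(W_i,E_{W_i},E^{*}_{W_i})$, where $E_{W_i}$ and $E^{*}_{W_i}$ are the sets of edges of $E$, respectively $E^{*}$, with both ends in $W_i$. Its set of R-neighbour sets is $\mathfrak{U}_{W_i}=\{U(v)\cap W_i\mid v\in W_i\}$. $\mathfrak{N}(\mathcal{R})=\{U\in\mathfrak{U}\mid |U|=1\}$ and $\mathfrak{L}(\mathcal{R})=\{U\in\mathfrak{U}\mid |U|>2\}$. *)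

theory Defs
  imports "Graph_Theory.Digraph_Component" "Graph_Theory.Vertex_Walk"
begin

text \<open>
  As in Graph_Theory, a finite simple undirected graph is a finite loop-free symmetric digraph
  (locale pair_graph): an edge vw is stored as the two arcs (v,w) and (w,v).
\<close>

record 'a rgraph =
  rverts :: "'a set"
  redges :: "'a rel"
  rstar :: "'a rel"

definition base_graph :: "'a rgraph \<Rightarrow> 'a pair_pre_digraph" where
  "base_graph R = \<lparr>pverts = rverts R, parcs = redges R\<rparr>"

definition star_graph :: "'a rgraph \<Rightarrow> 'a pair_pre_digraph" where
  "star_graph R = \<lparr>pverts = rverts R, parcs = rstar R\<rparr>"

text \<open>
  For a symmetric digraph, strong connectedness is connectedness, so sccs_verts consists of the
  vertex sets of the connected components (an isolated vertex v gives the component {v}).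
\<close>

abbreviation components :: "'a pair_pre_digraph \<Rightarrow> 'a set set" where
  "components G \<equiv> pre_digraph.sccs_verts (with_proj G)"

lemma components_conv_reachable:
  assumes "pair_graph G"
  shows "components G = (\<lambda>v. {w. v \<rightarrow>\<^sup>*\<^bsub>with_proj G\<^esub> w}) ` pverts G"
proof -
  interpret graph "with_proj G" using pair_graph.pair_graphD_graph[OF assms] .
  have "scc_of v = {w. v \<rightarrow>\<^sup>*\<^bsub>with_proj G\<^esub> w}" for v
    unfolding scc_of_def using symmetric_reachable[OF sym_arcs] by auto
  then show ?thesis using sccs_verts_conv_scc_of by simp
qed

definition r_nbr :: "'a rgraph \<Rightarrow> 'a \<Rightarrow> 'a set" where
  "r_nbr R v = {w \<in> rverts R. (v, w) \<in> rstar R} \<union> {v}"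

definition r_nbr_sets :: "'a rgraph \<Rightarrow> 'a set set" where
  "r_nbr_sets R = r_nbr R ` rverts R"

definition is_r_graph :: "'a rgraph \<Rightarrow> bool" where
  "is_r_graph R \<longleftrightarrow> pair_graph (base_graph R) \<and> pair_graph (star_graph R) \<and>
     (\<forall>v \<in> rverts R. \<forall>C \<in> components (base_graph R). card (r_nbr R v \<inter> C) \<le> 1)"

definition r_nonempty :: "'a rgraph \<Rightarrow> bool" where
  "r_nonempty R \<longleftrightarrow> redges R \<noteq> {}"

definition r_proper :: "'a rgraph \<Rightarrow> bool" where
  "r_proper R \<longleftrightarrow> (\<forall>v \<in> rverts R. \<exists>w. (v, w) \<in> redges R)"

text \<open>
  A path is the list of its vertices, with origin hd and terminus last.
\<close>

definition is_r_cycle :: "'a rgraph \<Rightarrow> 'a list list \<Rightarrow> bool" where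
  "is_r_cycle R \<pi> \<longleftrightarrow> length \<pi> > 1 \<and>
     (\<forall>p \<in> set \<pi>. vpath p (with_proj (base_graph R))) \<and>
     distinct (map hd \<pi> @ map last \<pi>) \<and>
     (\<forall>q < length \<pi> - 1. (last (\<pi> ! q), hd (\<pi> ! Suc q)) \<in> rstar R) \<and>
     (last (last \<pi>), hd (hd \<pi>)) \<in> rstar R"

definition r_simple :: "'a rgraph \<Rightarrow> bool" where
  "r_simple R \<longleftrightarrow>
     (\<forall>U \<in> r_nbr_sets R. \<forall>U' \<in> r_nbr_sets R. U \<inter> U' = {} \<or> U = U') \<and>
     (\<forall>v w v' w'. (v, w) \<in> redges R \<longrightarrow> (v', w') \<in> redges R \<longrightarrow>
        (v, v') \<in> rstar R \<longrightarrow> (w, w') \<notin> rstar R)"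

definition r_step :: "'a rgraph \<Rightarrow> 'a set rel" where
  "r_step R = {(U, U'). U \<in> r_nbr_sets R \<and> U' \<in> r_nbr_sets R \<and>
     (\<exists>v \<in> U. \<exists>w \<in> U'. (v, w) \<in> redges R)}"

definition r_connected :: "'a rgraph \<Rightarrow> 'a set rel" where
  "r_connected R = {(U, U'). U \<in> r_nbr_sets R \<and> U' \<in> r_nbr_sets R \<and> (U, U') \<in> (r_step R)\<^sup>*}"

definition r_induced :: "'a rgraph \<Rightarrow> 'a set \<Rightarrow> 'a rgraph" where
  "r_induced R W = \<lparr>rverts = W, redges = redges R \<inter> W \<times> W, rstar = rstar R \<inter> W \<times> W\<rparr>"

lemma r_nbr_sets_induced:
  assumes "W \<subseteq> rverts R"
  shows "r_nbr_sets (r_induced R W) = {r_nbr R v \<inter> W | v. v \<in> W}"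
proof -
  have "r_nbr (r_induced R W) v = r_nbr R v \<inter> W" if "v \<in> W" for v
    using that assms by (auto simp: r_nbr_def r_induced_def)
  then show ?thesis by (auto simp: r_nbr_sets_def r_induced_def)
qed

definition r_components :: "'a rgraph \<Rightarrow> 'a rgraph set" where
  "r_components R = (\<lambda>K. r_induced R (\<Union>K)) ` (r_nbr_sets R // r_connected R)"

definition r_small :: "'a rgraph \<Rightarrow> 'a set set" where
  "r_small R = {U \<in> r_nbr_sets R. card U = 1}"

definition r_large :: "'a rgraph \<Rightarrow> 'a set set" where
  "r_large R = {U \<in> r_nbr_sets R. card U > 2}"

end

theory Submission
  imports Defs
begin

text \<open>
  Regard every vertex \<open>v\<close> as an edge joining its R-neighbour set to its component. This gives a
  bipartite graph without multiple edges, whose components are the R-components and whose closed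
  trails are the R-cycles. A connected graph has at least as many edges as vertices minus one, with
  equality exactly if it is a tree, and this is the asserted criterion. If \<open>R\<close> is proper and
  has as many large R-neighbour sets as singletons, then vertices of the bipartite graph have
  average degree at least two on both sides, so there are at least as many edges as
  vertices, and a cycle exists.
\<close>

section \<open>Alternating cycles of two partitions\<close>

text \<open>Here \<open>f\<close> stands for the R-neighbour set, \<open>g\<close> for the
  component, and \<open>v q\<close>, \<open>w q\<close> for the ends of the \<open>q\<close>-th
  path. Only elements must be distinct, classes may recur: this is a closed trail, just as an
  R-cycle only restricts the ends of its paths.\<close>

definition alternating_cycle ::
    "('a \<Rightarrow> 'b) \<Rightarrow> ('a \<Rightarrow> 'c) \<Rightarrow> 'a set \<Rightarrow> nat \<Rightarrow> (nat \<Rightarrow> 'a) \<Rightarrow> (nat \<Rightarrow> 'a) \<Rightarrow> bool" where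
  "alternating_cycle f g X p v w \<longleftrightarrow> p > 1 \<and> v ` {..<p} \<subseteq> X \<and> w ` {..<p} \<subseteq> X \<and>
     inj_on v {..<p} \<and> inj_on w {..<p} \<and> v ` {..<p} \<inter> w ` {..<p} = {} \<and>
     (\<forall>q<p. g (v q) = g (w q)) \<and> (\<forall>q<p. f (w q) = f (v (Suc q mod p)))"

text \<open>Lists the cycle as one sequence \<open>z\<close> of \<open>2 * p\<close> elements,
  origins at even and termini at odd positions; parity then keeps the two kinds apart.\<close>

lemma alternating_cycleI:
  assumes p: "p > 1" and inj: "inj_on z {..<2 * p}" and X: "z ` {..<2 * p} \<subseteq> X"
    and g: "\<And>q. q < p \<Longrightarrow> g (z (2 * q)) = g (z (2 * q + 1))"
    and f: "\<And>q. Suc q < p \<Longrightarrow> f (z (2 * q + 1)) = f (z (2 * q + 2))"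
    and close: "f (z (2 * p - 1)) = f (z 0)"
  shows "alternating_cycle f g X p (\<lambda>q. z (2 * q)) (\<lambda>q. z (2 * q + 1))"
proof -
  have eq: "i = j" if "z i = z j" "i < 2 * p" "j < 2 * p" for i j
    using inj that by (auto dest: inj_onD)
  have "inj_on (\<lambda>q. z (2 * q)) {..<p}" "inj_on (\<lambda>q. z (2 * q + 1)) {..<p}"
    by (auto intro!: inj_onI dest!: eq)
  moreover have "z (2 * q) \<noteq> z (2 * r + 1)" if "q < p" "r < p" for q r
  proof
    assume "z (2 * q) = z (2 * r + 1)"
    from eq[OF this] that have "2 * q = 2 * r + 1" by simp
    then show False by presburger
  qed
  moreover have "f (z (2 * q + 1)) = f (z (2 * (Suc q mod p)))" if "q < p" for q
  proof (cases "Suc q < p")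
    case True
    then show ?thesis using f[OF True] by simp
  next
    case False
    with that have "p = Suc q" by simp
    then show ?thesis using close by simp
  qed
  ultimately show ?thesis
    using p X g by (fastforce simp: alternating_cycle_def)
qed

text \<open>
  Elements are edges between their \<open>f\<close>-class and their \<open>g\<close>-class. A walk that never backtracks
  must revisit a class, and a closed piece of minimal length repeats no element. If that piece
  starts at a \<open>g\<close>-class, its first element is moved to the end.
\<close>

lemma ex_alternating_cycle:
  assumes fin: "finite X" and ne: "x0 \<in> X" and inj: "inj_on (\<lambda>x. (f x, g x)) X"
    and f: "\<And>x. x \<in> X \<Longrightarrow> \<exists>y\<in>X. y \<noteq> x \<and> f y = f x"
    and g: "\<And>x. x \<in> X \<Longrightarrow> \<exists>y\<in>X. y \<noteq> x \<and> g y = g x"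
  shows "\<exists>p v w. alternating_cycle f g X p v w"
proof -
  obtain \<phi> where \<phi>: "\<And>x. x \<in> X \<Longrightarrow> \<phi> x \<in> X \<and> \<phi> x \<noteq> x \<and> f (\<phi> x) = f x" using f by metis
  obtain \<gamma> where \<gamma>: "\<And>x. x \<in> X \<Longrightarrow> \<gamma> x \<in> X \<and> \<gamma> x \<noteq> x \<and> g (\<gamma> x) = g x" using g by metis
  \<comment> \<open>The walk changes element inside a \<open>g\<close>-class after even indices and
    inside an \<open>f\<close>-class after odd ones.\<close>
  define x where "x = rec_nat x0 (\<lambda>k y. if even k then \<gamma> y else \<phi> y)"
  have x_Suc: "x (Suc k) = (if even k then \<gamma> (x k) else \<phi> (x k))" for k
    by (simp add: x_def)
  have xX: "x k \<in> X" for k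
    by (induction k) (use ne \<phi> \<gamma> x_Suc in \<open>auto simp: x_def\<close>)
  have x_neq: "x (Suc k) \<noteq> x k" for k using \<phi>[OF xX] \<gamma>[OF xX] x_Suc by auto
  have xg: "g (x (Suc k)) = g (x k)" if "even k" for k using that \<gamma>[OF xX] x_Suc by simp
  have xf: "f (x (Suc k)) = f (x k)" if "odd k" for k using that \<phi>[OF xX] x_Suc by simp
  \<comment> \<open>\<open>n k\<close> is the class through which \<open>x k\<close> is entered, and
    \<open>n (Suc k)\<close> the class through which it is left. The sum type separates the two
    sides of the bipartite graph, so equal nodes force equal parity.\<close>
  define n where "n k = (if even k then Inl (f (x k)) else Inr (g (x k)))" for k
  have n_Suc: "n (Suc k) = (if even k then Inr (g (x k)) else Inl (f (x k)))" for k
    using xg xf by (auto simp: n_def)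
  have parity: "even i \<longleftrightarrow> even j" if "n i = n j" for i j
    using that by (auto simp: n_def split: if_splits)
  have "range n \<subseteq> Inl ` f ` X \<union> Inr ` g ` X" using xX by (auto simp: n_def)
  then have "finite (range n)" by (rule finite_subset) (use fin in auto)
  then have "\<not> inj n" using finite_imageD infinite_UNIV_nat by blast
  then obtain a b where "n a = n b" "a < b" by (metis injI nat_neq_iff)
  then have ex: "\<exists>d>0. \<exists>i. n i = n (i + d)" by (metis less_imp_add_positive)
  \<comment> \<open>Minimal over all starting points \<open>i\<close> at once, so that every
    repetition of a node anywhere along the walk has gap at least \<open>d\<close>.\<close>
  define d where "d = (LEAST d. d > 0 \<and> (\<exists>i. n i = n (i + d)))"
  from LeastI_ex[OF ex] have "d > 0 \<and> (\<exists>i. n i = n (i + d))" unfolding d_def .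
  then obtain i where d0: "d > 0" and ni: "n i = n (i + d)" by blast
  have min: "l - k \<ge> d" if "n k = n l" "k < l" for k l
    unfolding d_def by (rule Least_le) (use that in \<open>auto intro!: exI[of _ k]\<close>)
  \<comment> \<open>With equal parity a repeated element is entered through the same node twice.
    With opposite parity it is traversed backwards the second time, so the node where it was left
    recurs as \<open>n l\<close>. Either way a gap smaller than \<open>d\<close> arises.\<close>
  have x_neq': "x k \<noteq> x l" if kl: "k < l" and "l - k < d" for k l
  proof
    assume eq: "x k = x l"
    show False
    proof (cases "even k \<longleftrightarrow> even l")
      case True
      then have "n k = n l" using eq by (simp add: n_def)
      then show False using min kl that by fastforce
    next
      case False
      then have "n (Suc k) = n l" using eq by (auto simp: n_def xf xg)
      moreover have "Suc k < l"
        using eq x_neq[of k] kl by (metis Suc_lessI)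
      ultimately show False using min[of "Suc k" l] that by linarith
    qed
  qed
  have "even d" using parity[OF ni] by (cases "even i") auto
  then obtain p where p: "d = 2 * p" by blast
  \<comment> \<open>A closed piece of length two would consist of distinct elements with both
    classes in common, a double edge, against \<open>inj\<close>.\<close>
  have "p \<noteq> 1"
  proof
    assume "p = 1"
    then have "n i = n (Suc (Suc i))" using ni p by simp
    then have "f (x i) = f (x (Suc i)) \<and> g (x i) = g (x (Suc i))"
      using xg[of i] xf[of i] unfolding n_Suc[of "Suc i"] by (auto simp: n_def split: if_splits)
    then show False using inj xX x_neq[of i] by (auto dest!: inj_onD)
  qed
  then have p1: "p > 1" using p d0 by simp
  have x_inj: "inj_on (\<lambda>t. x (i + t)) {..<2 * p}"
    by (rule linorder_inj_onI) (use x_neq' p in auto)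
  show ?thesis
  proof (cases "even i")
    case True
    \<comment> \<open>The repeated node is recorded at index \<open>i + 2 * p\<close>, one past the
      last element of the piece; the odd step before it stays in the same
      \<open>f\<close>-class.\<close>
    have "f (x (i + 2 * p)) = f (x i)"
      using ni p True by (auto simp: n_def split: if_splits)
    then have "f (x (i + (2 * p - 1))) = f (x i)"
      using xf[of "i + (2 * p - 1)"] True p1 by simp
    then have "alternating_cycle f g X p (\<lambda>q. x (i + (2 * q))) (\<lambda>q. x (i + (2 * q + 1)))"
      by (intro alternating_cycleI[where z = "\<lambda>t. x (i + t)"] p1 x_inj)
        (use True xX xf xg in auto)
    then show ?thesis by blast
  next
    case False
    define z where "z t = x (if Suc t = 2 * p then i else Suc i + t)" for t
    have "inj_on z {..<2 * p}"
    proof (rule inj_onI)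
      fix s t assume st: "s \<in> {..<2 * p}" "t \<in> {..<2 * p}" and "z s = z t"
      then have "(if Suc s = 2 * p then 0 else Suc s) = (if Suc t = 2 * p then 0 else Suc t)"
        by (intro inj_onD[OF x_inj]) (auto simp: z_def split: if_splits)
      then show "s = t" by (auto split: if_splits)
    qed
    \<comment> \<open>For odd \<open>i\<close> the repeated node yields the last
      \<open>g\<close>-pair, \<open>x (i + 2 * p - 1)\<close> with \<open>x i\<close>, while the
      closing \<open>f\<close>-pair is the ordinary step from \<open>x i\<close> to
      \<open>x (Suc i)\<close>.\<close>
    moreover have "g (x (i + 2 * p)) = g (x i)"
      using ni p False by (auto simp: n_def split: if_splits)
    then have "g (x i) = g (x (i + (2 * p - 1)))"
      using xg[of "i + (2 * p - 1)"] False p1 by simp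
    then have "g (z (2 * q)) = g (z (2 * q + 1))" if "q < p" for q
      using that False xg[of "Suc i + 2 * q"] by (cases "Suc q = p") (auto simp: z_def)
    moreover have "f (z (2 * q + 1)) = f (z (2 * q + 2))" if "Suc q < p" for q
      using that False xf[of "Suc i + (2 * q + 1)"] xf[of i]
      by (auto simp: z_def)
    moreover have "f (z (2 * p - 1)) = f (z 0)"
      using False xf[of i] p1 by (auto simp: z_def)
    moreover have "z ` {..<2 * p} \<subseteq> X" using xX by (auto simp: z_def)
    ultimately have "alternating_cycle f g X p (\<lambda>q. z (2 * q)) (\<lambda>q. z (2 * q + 1))"
      using p1 by (intro alternating_cycleI)
    then show ?thesis by blast
  qed
qed

lemma alternating_cycle_mono:
  "alternating_cycle f g X p v w \<Longrightarrow> X \<subseteq> Y \<Longrightarrow> alternating_cycle f g Y p v w"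
  by (auto simp: alternating_cycle_def)

section \<open>Counting elements against classes\<close>

text \<open>The forest bound. Without a cycle, \<open>ex_alternating_cycle\<close> leaves some
  element alone in one of its two classes; deleting this pendant edge also deletes a class, and
  induction applies.\<close>

lemma card_acyclic:
  assumes "finite X" "X \<noteq> {}" "inj_on (\<lambda>x. (f x, g x)) X"
    and "\<nexists>p v w. alternating_cycle f g X p v w"
  shows "card X + 1 \<le> card (f ` X) + card (g ` X)"
  using assms
proof (induction "card X" arbitrary: X rule: less_induct)
  case less
  from less.prems obtain x where x: "x \<in> X"
    and pendant: "(\<forall>y\<in>X. y \<noteq> x \<longrightarrow> f y \<noteq> f x) \<or> (\<forall>y\<in>X. y \<noteq> x \<longrightarrow> g y \<noteq> g x)"
    using ex_alternating_cycle[of X _ f g] by blast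
  let ?Y = "X - {x}"
  have X: "X = insert x ?Y" using x by blast
  have card_X: "card X = Suc (card ?Y)" using less.prems(1) x by (metis card_Suc_Diff1)
  have fg: "f ` X = insert (f x) (f ` ?Y)" "g ` X = insert (g x) (g ` ?Y)" using x by auto
  have fin: "finite (f ` ?Y)" "finite (g ` ?Y)" using less.prems(1) by auto
  from pendant have "f x \<notin> f ` ?Y \<or> g x \<notin> g ` ?Y" by force
  then have step: "card (f ` ?Y) + card (g ` ?Y) + 1 \<le> card (f ` X) + card (g ` X)"
    unfolding fg using fin by (auto simp: card_insert_if)
  show ?case
  proof (cases "?Y = {}")
    case True
    then have "X = {x}" using x by blast
    then show ?thesis by simp
  next
    case False
    have "card ?Y + 1 \<le> card (f ` ?Y) + card (g ` ?Y)"
    proof (rule less.hyps)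
      show "inj_on (\<lambda>x. (f x, g x)) ?Y" using less.prems(3) by (rule inj_on_subset) blast
      show "\<nexists>p v w. alternating_cycle f g ?Y p v w"
        using less.prems(4) alternating_cycle_mono[OF _ Diff_subset] by blast
    qed (use less.prems(1) False card_X in auto)
    with step card_X show ?thesis by linarith
  qed
qed

text \<open>Starting from \<open>S\<close>, elements are added one by one, each sharing a class with
  an earlier one and hence bringing at most one new class. So the excess of classes over elements
  does not grow from \<open>S\<close> to \<open>X\<close>. The start \<open>S\<close> is left free:
  a single element gives the tree bound, a cycle a bound better by one.\<close>

lemma card_connected:
  assumes "finite X" "S \<subseteq> X"
    and "\<And>T. S \<subseteq> T \<Longrightarrow> T \<subset> X \<Longrightarrow> \<exists>x\<in>X - T. f x \<in> f ` T \<or> g x \<in> g ` T"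
  shows "card (f ` X) + card (g ` X) + card S \<le> card X + card (f ` S) + card (g ` S)"
  using assms(2,3)
proof (induction "card (X - S)" arbitrary: S rule: less_induct)
  case less
  show ?case
  proof (cases "S = X")
    case False
    with less.prems obtain x where x: "x \<in> X - S" and fg: "f x \<in> f ` S \<or> g x \<in> g ` S"
      by (metis order_refl psubsetI)
    have fin: "finite S" using less.prems(1) assms(1) finite_subset by blast
    have "card (f ` X) + card (g ` X) + card (insert x S)
        \<le> card X + card (f ` insert x S) + card (g ` insert x S)"
    proof (rule less.hyps)
      show "card (X - insert x S) < card (X - S)"
        using x assms(1) by (intro psubset_card_mono) auto
    qed (use x less.prems in auto)
    moreover have "card (insert x S) = card S + 1" using x fin by simp
    moreover have "card (f ` insert x S) + card (g ` insert x S)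
        \<le> card (f ` S) + card (g ` S) + 1"
      using fg fin by (auto simp: card_insert_if insert_absorb)
    ultimately show ?thesis by linarith
  qed simp
qed

text \<open>Each class of some \<open>w q\<close> is also a class of some \<open>v r\<close>, so
  there are at most \<open>p\<close> classes of either kind against \<open>2 * p\<close>
  elements.\<close>

lemma card_alternating_cycle:
  assumes "alternating_cycle f g X p v w"
  defines "S \<equiv> v ` {..<p} \<union> w ` {..<p}"
  shows "card (f ` S) + card (g ` S) \<le> card S"
proof -
  have p: "p > 1" "card S = 2 * p"
    using assms by (auto simp: alternating_cycle_def S_def card_Un_disjoint card_image)
  have gw: "g (w q) \<in> g ` v ` {..<p}" and fw: "f (w q) \<in> f ` v ` {..<p}" if "q < p" for q
  proof -
    have "g (w q) = g (v q)" "f (w q) = f (v (Suc q mod p))" "Suc q mod p < p"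
      using assms(1) that by (auto simp: alternating_cycle_def)
    then show "g (w q) \<in> g ` v ` {..<p}" "f (w q) \<in> f ` v ` {..<p}" using that by auto
  qed
  have "f ` S = f ` v ` {..<p}" "g ` S = g ` v ` {..<p}"
    using gw fw by (auto simp: S_def)
  then have "card (f ` S) \<le> p" "card (g ` S) \<le> p"
    by (metis card_image_le card_lessThan finite_lessThan image_image)+
  then show ?thesis using p(2) by simp
qed

section \<open>R-graphs\<close>

definition component_of :: "'a rgraph \<Rightarrow> 'a \<Rightarrow> 'a set" where
  "component_of R v = {w. (v, w) \<in> (redges R)\<^sup>*}"

lemma reachable_base_graph:
  assumes "pair_graph (base_graph R)" "v \<in> rverts R"
  shows "v \<rightarrow>\<^sup>*\<^bsub>with_proj (base_graph R)\<^esub> w \<longleftrightarrow> (v, w) \<in> (redges R)\<^sup>*"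
proof -
  interpret pair_graph "base_graph R" by fact
  show ?thesis
  proof
    assume "(v, w) \<in> (redges R)\<^sup>*"
    then show "v \<rightarrow>\<^sup>*\<^bsub>with_proj (base_graph R)\<^esub> w"
    proof induction
      case base
      show ?case by (rule reachable_refl) (use assms(2) in \<open>simp add: base_graph_def\<close>)
    next
      case (step y z)
      from step.IH show ?case
        by (rule reachable_adj_trans) (use step.hyps in \<open>simp add: base_graph_def\<close>)
    qed
  qed (auto simp: reachable_def base_graph_def dest: rtrancl_on_rtranclI)
qed

lemma components_base_graph:
  assumes "pair_graph (base_graph R)"
  shows "components (base_graph R) = component_of R ` rverts R"
  unfolding components_conv_reachable[OF assms] component_of_def
  using reachable_base_graph[OF assms] by (auto simp: base_graph_def intro!: image_cong)

lemma pair_graph_induced: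
  assumes "pair_graph (base_graph R)" "W \<subseteq> rverts R"
  shows "pair_graph (base_graph (r_induced R W))"
proof -
  interpret pair_graph "base_graph R" by fact
  have "sym (redges R)"
    using sym_arcs by (simp add: symmetric_def base_graph_def)
  moreover have "finite (rverts R)"
    using pair_finite_verts by (simp add: base_graph_def)
  moreover have "fst e \<noteq> snd e" if "e \<in> redges R" for e
    using pair_no_loops that by (simp add: base_graph_def)
  ultimately show ?thesis
    using assms(2) unfolding r_induced_def base_graph_def
    by unfold_locales (auto simp: symmetric_def sym_def finite_subset)
qed

text \<open>A set closed under edges contains every walk that starts in it, so no connection is lost
  by restricting to it.\<close>

lemma component_of_induced:
  assumes "v \<in> W" "\<And>x y. (x, y) \<in> redges R \<Longrightarrow> x \<in> W \<Longrightarrow> y \<in> W"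
  shows "component_of (r_induced R W) v = component_of R v"
proof -
  have "(v, w) \<in> (redges R \<inter> W \<times> W)\<^sup>* \<and> w \<in> W" if "(v, w) \<in> (redges R)\<^sup>*" for w
    using that
  proof induction
    case (step y z)
    then have "(y, z) \<in> redges R \<inter> W \<times> W" "z \<in> W" using assms(2) by auto
    with step.IH show ?case by (meson rtrancl.rtrancl_into_rtrancl)
  qed (use assms(1) in auto)
  then show ?thesis
    using rtrancl_mono[of "redges R \<inter> W \<times> W" "redges R"]
    by (auto simp: component_of_def r_induced_def)
qed

lemma rverts_induced: "rverts (r_induced R W) = W"
  by (simp add: r_induced_def)

section \<open>R-neighbour sets and components as two partitions\<close>

locale partitioned_r_graph =
  fixes R :: "'a rgraph"
  assumes r_graph: "is_r_graph R"
    and nbr_sets_disjoint: "\<And>U U'. U \<in> r_nbr_sets R \<Longrightarrow> U' \<in> r_nbr_sets R \<Longrightarrow>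
      U \<inter> U' = {} \<or> U = U'"
begin

sublocale base: pair_graph "base_graph R"
  using r_graph by (simp add: is_r_graph_def)

lemma finite_rverts: "finite (rverts R)"
  using base.pair_finite_verts by (simp add: base_graph_def)

lemma redges_in_rverts: "(v, w) \<in> redges R \<Longrightarrow> v \<in> rverts R \<and> w \<in> rverts R"
  using base.in_arcsD1 base.in_arcsD2 by (auto simp: base_graph_def)

lemma sym_redges: "sym (redges R)"
  using base.sym_arcs by (simp add: symmetric_def base_graph_def)

text \<open>Every vertex lies in its own R-neighbour set, so disjointness makes
  \<open>r_nbr R\<close> the class map of a partition and allows it to play the role of
  \<open>f\<close>.\<close>

lemma mem_r_nbr_iff:
  assumes "v \<in> rverts R"
  shows "w \<in> r_nbr R v \<longleftrightarrow> w \<in> rverts R \<and> r_nbr R w = r_nbr R v"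
proof
  assume w: "w \<in> r_nbr R v"
  then have "w \<in> rverts R" using assms by (auto simp: r_nbr_def)
  moreover have "w \<in> r_nbr R w" by (simp add: r_nbr_def)
  ultimately show "w \<in> rverts R \<and> r_nbr R w = r_nbr R v"
    using w assms nbr_sets_disjoint[of "r_nbr R w" "r_nbr R v"] by (auto simp: r_nbr_sets_def)
next
  assume "w \<in> rverts R \<and> r_nbr R w = r_nbr R v"
  moreover have "w \<in> r_nbr R w" by (simp add: r_nbr_def)
  ultimately show "w \<in> r_nbr R v" by simp
qed

lemma r_nbr_eq_iff:
  assumes "v \<in> rverts R" "w \<in> rverts R" "v \<noteq> w"
  shows "r_nbr R v = r_nbr R w \<longleftrightarrow> (v, w) \<in> rstar R"
  using mem_r_nbr_iff[OF assms(1), of w] assms by (auto simp: r_nbr_def)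

lemma component_of_eq_iff: "component_of R v = component_of R w \<longleftrightarrow> (v, w) \<in> (redges R)\<^sup>*"
proof
  assume "component_of R v = component_of R w"
  moreover have "w \<in> component_of R w" by (simp add: component_of_def)
  ultimately show "(v, w) \<in> (redges R)\<^sup>*" by (auto simp: component_of_def)
next
  assume vw: "(v, w) \<in> (redges R)\<^sup>*"
  with sym_rtrancl[OF sym_redges] have wv: "(w, v) \<in> (redges R)\<^sup>*" by (rule symD)
  show "component_of R v = component_of R w"
    using rtrancl_trans[OF vw] rtrancl_trans[OF wv] by (auto simp: component_of_def)
qed

text \<open>The condition that an R-neighbour set meets a component at most once, read as the
  absence of multiple edges in the bipartite graph.\<close>

lemma inj_on_nbr_component: "inj_on (\<lambda>v. (r_nbr R v, component_of R v)) (rverts R)"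
proof (rule inj_onI)
  fix v w
  assume v: "v \<in> rverts R" and w: "w \<in> rverts R"
    and "(r_nbr R v, component_of R v) = (r_nbr R w, component_of R w)"
  then have "v \<in> r_nbr R v \<inter> component_of R v" "w \<in> r_nbr R v \<inter> component_of R v"
    using mem_r_nbr_iff by (auto simp: component_of_def)
  moreover have "finite (r_nbr R v \<inter> component_of R v)"
    using finite_rverts by (simp add: r_nbr_def)
  moreover have "card (r_nbr R v \<inter> component_of R v) \<le> Suc 0"
    using r_graph v components_base_graph[OF base.pair_graph_axioms] by (auto simp: is_r_graph_def)
  ultimately show "v = w" by (simp only: card_le_Suc0_iff_eq)
qed

section \<open>R-cycles as alternating cycles\<close>

lemma ex_vpath:
  assumes "v \<in> rverts R" "component_of R v = component_of R w"
  shows "\<exists>P. vpath P (with_proj (base_graph R)) \<and> hd P = v \<and> last P = w"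
proof -
  have "v \<rightarrow>\<^sup>*\<^bsub>with_proj (base_graph R)\<^esub> w"
    using assms reachable_base_graph[OF base.pair_graph_axioms] component_of_eq_iff by blast
  then show ?thesis
    using base.reachable_vwalk_conv vwalk_imp_ex_vpath by metis
qed

text \<open>A common component supplies each path. A common R-neighbour set supplies each star edge,
  because the two vertices are distinct: origins and termini are disjoint.\<close>

lemma r_cycle_of_alternating_cycle:
  assumes "alternating_cycle (r_nbr R) (component_of R) (rverts R) p v w"
  shows "\<exists>\<pi>. is_r_cycle R \<pi>"
proof -
  note ac = assms[unfolded alternating_cycle_def]
  have "\<exists>P. vpath P (with_proj (base_graph R)) \<and> hd P = v q \<and> last P = w q" if "q < p" for q
    using ac that by (intro ex_vpath) auto
  then obtain P where P: "\<And>q. q < p \<Longrightarrow>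
      vpath (P q) (with_proj (base_graph R)) \<and> hd (P q) = v q \<and> last (P q) = w q"
    by metis
  have star: "(w q, v (Suc q mod p)) \<in> rstar R" if "q < p" for q
  proof -
    have "Suc q mod p < p" using ac by simp
    then have "w q \<in> rverts R" "v (Suc q mod p) \<in> rverts R" "w q \<noteq> v (Suc q mod p)"
      using ac that by blast+
    moreover have "r_nbr R (w q) = r_nbr R (v (Suc q mod p))" using ac that by blast
    ultimately show ?thesis using r_nbr_eq_iff by metis
  qed
  define \<pi> where "\<pi> = map P [0..<p]"
  have len: "length \<pi> = p" by (simp add: \<pi>_def)
  have "map hd \<pi> = map v [0..<p]" "map last \<pi> = map w [0..<p]"
    using P by (auto simp: \<pi>_def)
  then have "distinct (map hd \<pi> @ map last \<pi>)"
    using ac by (auto simp: distinct_map lessThan_atLeast0)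
  moreover have "\<forall>q<length \<pi> - 1. (last (\<pi> ! q), hd (\<pi> ! Suc q)) \<in> rstar R"
  proof (intro allI impI)
    fix q assume "q < length \<pi> - 1"
    then have "Suc q < p" by (simp add: len)
    with star[of q] P show "(last (\<pi> ! q), hd (\<pi> ! Suc q)) \<in> rstar R" by (simp add: \<pi>_def)
  qed
  \<comment> \<open>The index \<open>p - 1\<close> wraps around to \<open>0\<close>.\<close>
  moreover have "(last (last \<pi>), hd (hd \<pi>)) \<in> rstar R"
    using star[of "p - 1"] P ac by (simp add: \<pi>_def last_map hd_map)
  ultimately have "is_r_cycle R \<pi>"
    using P ac unfolding is_r_cycle_def by (auto simp: \<pi>_def)
  then show ?thesis by blast
qed

lemma alternating_cycle_of_r_cycle:
  assumes "is_r_cycle R \<pi>"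
  shows "alternating_cycle (r_nbr R) (component_of R) (rverts R) (length \<pi>)
    (\<lambda>q. hd (\<pi> ! q)) (\<lambda>q. last (\<pi> ! q))"
proof -
  let ?p = "length \<pi>"
  note rc = assms[unfolded is_r_cycle_def]
  have path: "vpath (\<pi> ! q) (with_proj (base_graph R))" if "q < ?p" for q
    using rc that by simp
  have verts: "hd (\<pi> ! q) \<in> rverts R \<and> last (\<pi> ! q) \<in> rverts R" if "q < ?p" for q
    using path[OF that] hd_in_set last_in_set
    by (fastforce simp: vpath_def vwalk_def base_graph_def)
  have "hd (\<pi> ! q) \<rightarrow>\<^sup>*\<^bsub>with_proj (base_graph R)\<^esub> last (\<pi> ! q)" if "q < ?p" for q
    using path[OF that] base.reachable_vwalk_conv by (auto simp: vpath_def)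
  then have comp: "component_of R (hd (\<pi> ! q)) = component_of R (last (\<pi> ! q))" if "q < ?p" for q
    using that verts reachable_base_graph[OF base.pair_graph_axioms] component_of_eq_iff by blast
  have star: "(last (\<pi> ! q), hd (\<pi> ! (Suc q mod ?p))) \<in> rstar R" if "q < ?p" for q
  proof (cases "Suc q < ?p")
    case True
    then show ?thesis using rc by simp
  next
    case False
    with that have "Suc q = ?p" by simp
    then have "q = ?p - 1" "Suc q mod ?p = 0" "\<pi> \<noteq> []" by auto
    then show ?thesis using rc by (simp add: last_conv_nth hd_conv_nth)
  qed
  \<comment> \<open>Distinctness of the concatenated list also covers \<open>q = r\<close>, so no
    path of an R-cycle is a single vertex.\<close>
  have hd_last: "hd (\<pi> ! q) \<noteq> last (\<pi> ! r)" if "q < ?p" "r < ?p" for q r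
  proof -
    have "hd (\<pi> ! q) \<in> set (map hd \<pi>)" "last (\<pi> ! r) \<in> set (map last \<pi>)"
      using that by auto
    moreover have "set (map hd \<pi>) \<inter> set (map last \<pi>) = {}"
      using rc by (simp only: distinct_append)
    ultimately show ?thesis by (metis disjoint_iff)
  qed
  have nbr: "r_nbr R (last (\<pi> ! q)) = r_nbr R (hd (\<pi> ! (Suc q mod ?p)))" if "q < ?p" for q
  proof -
    have "Suc q mod ?p < ?p" using that mod_less_divisor[of ?p "Suc q"] by linarith
    then show ?thesis
      using r_nbr_eq_iff[of "last (\<pi> ! q)" "hd (\<pi> ! (Suc q mod ?p))"] star[OF that]
        verts[OF that] verts[of "Suc q mod ?p"] hd_last[of "Suc q mod ?p" q] that by metis
  qed
  have inj: "inj_on (\<lambda>q. h (\<pi> ! q)) {..<?p}" if "distinct (map h \<pi>)" for h :: "'a list \<Rightarrow> 'a"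
    using that by (auto simp: inj_on_def distinct_conv_nth)
  have "inj_on (\<lambda>q. hd (\<pi> ! q)) {..<?p}" "inj_on (\<lambda>q. last (\<pi> ! q)) {..<?p}"
    using rc by (auto intro: inj)
  moreover have "(\<lambda>q. hd (\<pi> ! q)) ` {..<?p} \<inter> (\<lambda>q. last (\<pi> ! q)) ` {..<?p} = {}"
    using hd_last by blast
  moreover have "?p > 1" using rc by blast
  ultimately show ?thesis
    using verts comp nbr unfolding alternating_cycle_def by blast
qed

section \<open>R-components\<close>

text \<open>For a vertex \<open>u\<close>, this is the set W of the R-component containing
  \<open>u\<close>. In the bipartite graph it is the edge set of a connected component.\<close>

definition r_component_verts :: "'a \<Rightarrow> 'a set" where
  "r_component_verts u = {v \<in> rverts R. (r_nbr R u, r_nbr R v) \<in> (r_step R)\<^sup>*}"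

lemma r_component_verts_subset: "r_component_verts u \<subseteq> rverts R"
  by (auto simp: r_component_verts_def)

lemma r_components_eq:
  "r_components R = (\<lambda>u. r_induced R (r_component_verts u)) ` rverts R"
proof -
  have "\<Union> (r_connected R `` {r_nbr R u}) = r_component_verts u" if "u \<in> rverts R" for u
  proof (intro equalityI subsetI)
    fix x assume "x \<in> \<Union> (r_connected R `` {r_nbr R u})"
    then obtain v where "v \<in> rverts R" "(r_nbr R u, r_nbr R v) \<in> (r_step R)\<^sup>*" "x \<in> r_nbr R v"
      by (auto simp: r_connected_def r_nbr_sets_def)
    then show "x \<in> r_component_verts u"
      using mem_r_nbr_iff by (auto simp: r_component_verts_def)
  next
    fix x assume "x \<in> r_component_verts u"
    then show "x \<in> \<Union> (r_connected R `` {r_nbr R u})"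
      using that mem_r_nbr_iff
      by (auto simp: r_component_verts_def r_connected_def r_nbr_sets_def)
  qed
  then show ?thesis
    by (auto simp: r_components_def quotient_def r_nbr_sets_def image_iff)
qed

lemma r_step_r_nbr: "(v, w) \<in> redges R \<Longrightarrow> (r_nbr R v, r_nbr R w) \<in> r_step R"
  using redges_in_rverts by (auto simp: r_step_def r_nbr_sets_def r_nbr_def)

lemma redges_in_r_component:
  assumes "(x, y) \<in> redges R" "x \<in> r_component_verts u"
  shows "y \<in> r_component_verts u"
  using rtrancl_into_rtrancl[OF _ r_step_r_nbr[OF assms(1)]] redges_in_rverts[OF assms(1)] assms(2)
  by (simp add: r_component_verts_def)

lemma r_component_verts_closed:
  assumes "x \<in> r_component_verts u" "y \<in> rverts R"
    and "r_nbr R x = r_nbr R y \<or> component_of R x = component_of R y"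
  shows "y \<in> r_component_verts u"
  using assms(3)
proof
  assume "component_of R x = component_of R y"
  then have "(x, y) \<in> (redges R)\<^sup>*" by (simp add: component_of_eq_iff)
  then show ?thesis
    by induction (use assms(1) redges_in_r_component in auto)
qed (use assms(1,2) in \<open>simp add: r_component_verts_def\<close>)

lemma sym_r_step: "sym (r_step R)"
proof (rule symI)
  fix U U' assume "(U, U') \<in> r_step R"
  then show "(U', U) \<in> r_step R"
    unfolding r_step_def using symD[OF sym_redges] by blast
qed

text \<open>Provides the growth hypothesis of \<open>card_connected\<close>. A set \<open>T\<close>
  that cannot be extended is closed under sharing a class, hence absorbs everything reachable by
  \<open>r_step\<close> from one of its members, which is the whole R-component.\<close>

lemma r_component_verts_connected:
  assumes "T \<noteq> {}" "T \<subset> r_component_verts u"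
  shows "\<exists>x\<in>r_component_verts u - T.
    r_nbr R x \<in> r_nbr R ` T \<or> component_of R x \<in> component_of R ` T"
proof (rule ccontr)
  assume no_ext: "\<not> ?thesis"
  have T: "y \<in> T" if "x \<in> T" "y \<in> rverts R"
      "r_nbr R x = r_nbr R y \<or> component_of R x = component_of R y" for x y
  proof (rule ccontr)
    assume "y \<notin> T"
    moreover have "y \<in> r_component_verts u"
      using r_component_verts_closed[of x u y] that assms(2) by blast
    ultimately have "r_nbr R y \<notin> r_nbr R ` T" "component_of R y \<notin> component_of R ` T"
      using no_ext by blast+
    then show False using that by (metis imageI)
  qed
  from assms obtain s where s: "s \<in> T" "s \<in> r_component_verts u" by blast
  have sub: "U \<subseteq> T" if "(r_nbr R s, U) \<in> (r_step R)\<^sup>*" for U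
    using that
  proof induction
    case base
    show ?case
      using s T[OF s(1)] r_component_verts_subset mem_r_nbr_iff[of s] by blast
  next
    case (step U U')
    then obtain v w z where vw: "v \<in> T" "(v, w) \<in> redges R"
      and U': "w \<in> U'" "z \<in> rverts R" "U' = r_nbr R z"
      by (auto simp: r_step_def r_nbr_sets_def)
    have "component_of R v = component_of R w"
      using vw(2) component_of_eq_iff by blast
    then have w: "w \<in> T" using T vw redges_in_rverts by blast
    show ?case
      using T[OF w] U' mem_r_nbr_iff[OF U'(2)] by auto
  qed
  have "v \<in> T" if "v \<in> r_component_verts u" for v
  proof -
    \<comment> \<open>By symmetry of \<open>r_step\<close> one returns from \<open>s\<close> to the
      base vertex \<open>u\<close> and goes on from there to \<open>v\<close>.\<close>
    have "(r_nbr R s, r_nbr R u) \<in> (r_step R)\<^sup>*"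
      using s(2) sym_rtrancl[OF sym_r_step] by (auto simp: r_component_verts_def dest: symD)
    then have "(r_nbr R s, r_nbr R v) \<in> (r_step R)\<^sup>*"
      using that by (auto simp: r_component_verts_def)
    then show ?thesis using sub by (fastforce simp: r_nbr_def)
  qed
  with assms(2) show False by blast
qed

text \<open>An R-component contains the whole R-neighbour set of each of its vertices, so
  intersecting with it cuts nothing off.\<close>

lemma r_nbr_sets_r_component:
  "r_nbr_sets (r_induced R (r_component_verts u)) = r_nbr R ` r_component_verts u"
proof -
  have "r_nbr R v \<subseteq> r_component_verts u" if v: "v \<in> r_component_verts u" for v
  proof
    fix y assume "y \<in> r_nbr R v"
    then show "y \<in> r_component_verts u"
      using v r_component_verts_subset mem_r_nbr_iff[of v y] r_component_verts_closed[OF v, of y]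
      by blast
  qed
  then have "r_nbr R v \<inter> r_component_verts u = r_nbr R v" if "v \<in> r_component_verts u" for v
    using that by blast
  then show ?thesis
    unfolding r_nbr_sets_induced[OF r_component_verts_subset] by force
qed

text \<open>No edge leaves an R-component, so its connected components are full components of the
  whole graph.\<close>

lemma components_r_component:
  "components (base_graph (r_induced R (r_component_verts u)))
    = component_of R ` r_component_verts u"
proof -
  have "components (base_graph (r_induced R (r_component_verts u)))
      = component_of (r_induced R (r_component_verts u)) ` r_component_verts u"
    using components_base_graph[OF pair_graph_induced[OF base.pair_graph_axioms
      r_component_verts_subset]] by (simp add: r_induced_def)
  also have "\<dots> = component_of R ` r_component_verts u"
    using redges_in_r_component by (auto intro!: image_cong component_of_induced)
  finally show ?thesis .
qed

lemma finite_r_component_verts: "finite (r_component_verts u)"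
  using r_component_verts_subset finite_rverts by (rule finite_subset)

section \<open>The counting criterion\<close>

text \<open>Growth from the single vertex \<open>u\<close>: a connected graph has at most one more
  node than edges. Hence the number in the criterion is never negative.\<close>

lemma card_r_component:
  assumes "u \<in> rverts R"
  shows "card (r_nbr R ` r_component_verts u) + card (component_of R ` r_component_verts u)
    \<le> card (r_component_verts u) + 1"
proof -
  have "u \<in> r_component_verts u" using assms by (simp add: r_component_verts_def)
  then have "card (r_nbr R ` r_component_verts u) + card (component_of R ` r_component_verts u)
      + card {u} \<le> card (r_component_verts u) + card (r_nbr R ` {u}) + card (component_of R ` {u})"
    by (intro card_connected finite_r_component_verts r_component_verts_connected) auto
  then show ?thesis by simp
qed

text \<open>Contraposition of \<open>card_acyclic\<close>. The set \<open>X\<close> is kept general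
  because it is used both for an R-component and for the whole vertex set.\<close>

lemma ex_r_cycle_if_card:
  assumes "X \<subseteq> rverts R" "X \<noteq> {}"
    and "card (r_nbr R ` X) + card (component_of R ` X) \<le> card X"
  shows "\<exists>\<pi>. is_r_cycle R \<pi>"
proof -
  have "finite X" using assms(1) finite_rverts by (rule finite_subset)
  moreover have "inj_on (\<lambda>v. (r_nbr R v, component_of R v)) X"
    using inj_on_nbr_component assms(1) by (rule inj_on_subset)
  ultimately obtain p v w where "alternating_cycle (r_nbr R) (component_of R) X p v w"
    using card_acyclic[of X "r_nbr R" "component_of R"] assms(2,3) by fastforce
  then show ?thesis
    using r_cycle_of_alternating_cycle alternating_cycle_mono assms(1) by metis
qed

text \<open>All ends of the paths of an R-cycle lie in one R-component. Growing that component from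
  these ends, which already number at least as many as their classes, saves the 1 in
  \<open>card_r_component\<close>.\<close>

lemma r_cycle_card:
  assumes "is_r_cycle R \<pi>"
  shows "\<exists>u\<in>rverts R. card (r_nbr R ` r_component_verts u)
    + card (component_of R ` r_component_verts u) \<le> card (r_component_verts u)"
proof -
  obtain p v w where ac: "alternating_cycle (r_nbr R) (component_of R) (rverts R) p v w"
    using alternating_cycle_of_r_cycle[OF assms] by blast
  note ac' = ac[unfolded alternating_cycle_def]
  define S where "S = v ` {..<p} \<union> w ` {..<p}"
  define W where "W = r_component_verts (v 0)"
  have v0: "v 0 \<in> rverts R" using ac' by auto
  \<comment> \<open>Following the cycle: the component leads from \<open>v q\<close> to
    \<open>w q\<close>, the R-neighbour set from \<open>w q\<close> to
    \<open>v (Suc q)\<close>.\<close>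
  have vW: "v q \<in> W \<and> w q \<in> W" if "q < p" for q
    using that
  proof (induction q)
    case 0
    have "v 0 \<in> W" using v0 by (simp add: W_def r_component_verts_def)
    moreover have "w 0 \<in> W"
      unfolding W_def
      by (rule r_component_verts_closed[of "v 0"])
        (use \<open>v 0 \<in> W\<close> 0 ac' in \<open>auto simp: W_def\<close>)
    ultimately show ?case by blast
  next
    case (Suc q)
    then have "w q \<in> W" by simp
    have "\<forall>q<p. r_nbr R (w q) = r_nbr R (v (Suc q mod p))" using ac' by blast
    with Suc.prems have "r_nbr R (w q) = r_nbr R (v (Suc q))" by (metis Suc_lessD mod_less)
    moreover have "v (Suc q) \<in> rverts R" using ac' Suc.prems by blast
    ultimately have "v (Suc q) \<in> W"
      using \<open>w q \<in> W\<close> unfolding W_def by (blast intro: r_component_verts_closed)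
    moreover have "w (Suc q) \<in> W"
      unfolding W_def
      by (rule r_component_verts_closed[of "v (Suc q)"])
        (use \<open>v (Suc q) \<in> W\<close> Suc.prems ac' in \<open>auto simp: W_def\<close>)
    ultimately show ?case by blast
  qed
  have "S \<noteq> {}" using ac' by (auto simp: S_def)
  have "S \<subseteq> W" using vW by (auto simp: S_def)
  then have "card (r_nbr R ` W) + card (component_of R ` W) + card S
      \<le> card W + card (r_nbr R ` S) + card (component_of R ` S)"
    unfolding W_def
    by (intro card_connected finite_r_component_verts r_component_verts_connected)
      (use \<open>S \<noteq> {}\<close> in auto)
  moreover have "card (r_nbr R ` S) + card (component_of R ` S) \<le> card S"
    using card_alternating_cycle[OF ac] by (simp add: S_def)
  ultimately show ?thesis using v0 by (intro bexI[of _ "v 0"]) (simp add: W_def)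
qed

lemma ex_r_cycle_iff:
  "(\<exists>\<pi>. is_r_cycle R \<pi>) \<longleftrightarrow> (\<exists>H \<in> r_components R.
     int (card (rverts H)) - int (card (r_nbr_sets H))
       - int (card (components (base_graph H))) + 1 \<noteq> 0)"
proof -
  \<comment> \<open>The number is at least 0 by \<open>card_r_component\<close>, so being nonzero
    means being at least 1.\<close>
  have H: "int (card (rverts H)) - int (card (r_nbr_sets H))
       - int (card (components (base_graph H))) + 1 \<noteq> 0 \<longleftrightarrow>
      card (r_nbr R ` r_component_verts u) + card (component_of R ` r_component_verts u)
        \<le> card (r_component_verts u)"
    if "u \<in> rverts R" "H = r_induced R (r_component_verts u)" for u H
    using card_r_component[OF that(1)]
    unfolding that(2) r_nbr_sets_r_component components_r_component rverts_induced by arith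
  show ?thesis
  proof
    assume "\<exists>\<pi>. is_r_cycle R \<pi>"
    then show "\<exists>H \<in> r_components R. int (card (rverts H)) - int (card (r_nbr_sets H))
        - int (card (components (base_graph H))) + 1 \<noteq> 0"
      using r_cycle_card H unfolding r_components_eq by blast
  next
    assume "\<exists>H \<in> r_components R. int (card (rverts H)) - int (card (r_nbr_sets H))
        - int (card (components (base_graph H))) + 1 \<noteq> 0"
    then obtain u where u: "u \<in> rverts R" and
      card: "card (r_nbr R ` r_component_verts u) + card (component_of R ` r_component_verts u)
        \<le> card (r_component_verts u)"
      using H unfolding r_components_eq by blast
    have "u \<in> r_component_verts u" using u by (simp add: r_component_verts_def)
    then show "\<exists>\<pi>. is_r_cycle R \<pi>"
      using ex_r_cycle_if_card[OF r_component_verts_subset _ card] by blast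
  qed
qed

section \<open>Proper R-graphs with enough large R-neighbour sets\<close>

lemma card_rverts_nbr_sets: "card (rverts R) = (\<Sum>U\<in>r_nbr_sets R. card U)"
proof -
  have "rverts R = \<Union> (r_nbr_sets R)"
    by (auto simp: r_nbr_sets_def r_nbr_def)
  moreover have "card (\<Union> (r_nbr_sets R)) = (\<Sum>U\<in>r_nbr_sets R. card U)"
  proof (rule card_Union_disjoint)
    show "pairwise disjnt (r_nbr_sets R)"
      using nbr_sets_disjoint by (fastforce simp: pairwise_def disjnt_def)
    show "finite U" if "U \<in> r_nbr_sets R" for U
      using that finite_rverts by (auto simp: r_nbr_sets_def r_nbr_def)
  qed
  ultimately show ?thesis by simp
qed

text \<open>Measured against size two, a singleton lacks one vertex and a large set has at least one
  to spare, so the large sets compensate for the singletons.\<close>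

lemma card_nbr_sets_bound:
  assumes "card (r_small R) \<le> card (r_large R)"
  shows "2 * card (r_nbr_sets R) \<le> card (rverts R)"
proof -
  have fin: "finite (r_nbr_sets R)" using finite_rverts by (simp add: r_nbr_sets_def)
  have pos: "card U \<ge> 1" if "U \<in> r_nbr_sets R" for U
  proof -
    have "finite U \<and> U \<noteq> {}" using that finite_rverts by (auto simp: r_nbr_sets_def r_nbr_def)
    then show ?thesis by (simp add: Suc_leI card_gt_0_iff)
  qed
  have small: "card (r_small R) = (\<Sum>U\<in>r_nbr_sets R. if card U = 1 then 1 else 0)"
    unfolding r_small_def by (subst sum.inter_filter[OF fin, symmetric]) simp
  have large: "card (r_large R) = (\<Sum>U\<in>r_nbr_sets R. if card U > 2 then 1 else 0)"
    unfolding r_large_def by (subst sum.inter_filter[OF fin, symmetric]) simp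
  have "2 * card (r_nbr_sets R) + card (r_large R)
      = (\<Sum>U\<in>r_nbr_sets R. 2 + (if card U > 2 then 1 else 0))"
    unfolding large sum.distrib by simp
  \<comment> \<open>Termwise, by the cases of size 1, size 2 and size greater than 2.\<close>
  also have "\<dots> \<le> (\<Sum>U\<in>r_nbr_sets R. card U + (if card U = 1 then 1 else 0))"
    by (rule sum_mono) (use pos in fastforce)
  also have "\<dots> = card (rverts R) + card (r_small R)"
    by (simp add: small card_rverts_nbr_sets sum.distrib)
  finally show ?thesis using assms by linarith
qed

text \<open>In a proper R-graph every vertex has a neighbour, different from it as there are no
  loops, so every component has at least two vertices.\<close>

lemma card_components_bound:
  assumes "r_proper R"
  shows "2 * card (component_of R ` rverts R) \<le> card (rverts R)"
proof -
  let ?V = "rverts R" and ?CC = "component_of R ` rverts R"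
  have sub: "component_of R v \<subseteq> ?V" if "v \<in> ?V" for v
  proof
    fix w assume "w \<in> component_of R v"
    then have "(v, w) \<in> (redges R)\<^sup>*" by (simp add: component_of_def)
    then show "w \<in> ?V" by induction (use that redges_in_rverts in auto)
  qed
  have mem: "component_of R x = component_of R v" if "x \<in> component_of R v" for x v
    using that component_of_eq_iff[of v x] by (simp add: component_of_def)
  have "?V = \<Union> ?CC" using sub by (auto simp: component_of_def)
  moreover have "card (\<Union> ?CC) = (\<Sum>C\<in>?CC. card C)"
  proof (rule card_Union_disjoint)
    show "pairwise disjnt ?CC"
    proof (rule pairwiseI)
      fix C D assume CD: "C \<in> ?CC" "D \<in> ?CC" "C \<noteq> D"
      have "C = D" if "x \<in> C" "x \<in> D" for x using CD(1,2) that mem by blast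
      with CD(3) show "disjnt C D" by (auto simp: disjnt_def)
    qed
    show "finite C" if "C \<in> ?CC" for C
      using that sub finite_rverts finite_subset by blast
  qed
  ultimately have sum: "card ?V = (\<Sum>C\<in>?CC. card C)" by simp
  have "2 \<le> card C" if "C \<in> ?CC" for C
  proof -
    from that obtain v where v: "v \<in> ?V" "C = component_of R v" by blast
    then obtain w where vw: "(v, w) \<in> redges R" using assms by (auto simp: r_proper_def)
    then have "v \<noteq> w" using base.pair_no_loops by (force simp: base_graph_def)
    have "{v, w} \<subseteq> C" using vw v by (auto simp: component_of_def)
    moreover have "finite C"
      using v(2) sub[OF v(1)] finite_rverts finite_subset by metis
    ultimately have "card {v, w} \<le> card C" by (intro card_mono)
    moreover have "card {v, w} = 2" using \<open>v \<noteq> w\<close> by simp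
    ultimately show ?thesis by simp
  qed
  then have "(\<Sum>C\<in>?CC. 2) \<le> card ?V" unfolding sum by (rule sum_mono)
  then show ?thesis by simp
qed

end

theorem theorem3p16:
  fixes R :: "'a rgraph"
  assumes "is_r_graph R" and "r_nonempty R" and "r_simple R"
  shows "((\<exists>\<pi>. is_r_cycle R \<pi>) \<longleftrightarrow>
            (\<exists>H \<in> r_components R.
               int (card (rverts H)) - int (card (r_nbr_sets H))
                 - int (card (components (base_graph H))) + 1 \<noteq> 0))
         \<and> (r_proper R \<and> card (r_large R) \<ge> card (r_small R) \<longrightarrow> (\<exists>\<pi>. is_r_cycle R \<pi>))"
proof -
  interpret partitioned_r_graph R
    using assms(1,3) by unfold_locales (auto simp: r_simple_def)
  from assms(2) have ne: "rverts R \<noteq> {}"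
    using redges_in_rverts by (auto simp: r_nonempty_def)
  \<comment> \<open>Half of the sum of the two bounds says that the whole vertex set has at least as
    many elements as classes.\<close>
  have "\<exists>\<pi>. is_r_cycle R \<pi>" if "r_proper R" "card (r_large R) \<ge> card (r_small R)"
    using card_nbr_sets_bound[OF that(2)] card_components_bound[OF that(1)] ne
    by (intro ex_r_cycle_if_card[of "rverts R"]) (auto simp: r_nbr_sets_def)
  with ex_r_cycle_iff show ?thesis by blast
qed

end
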